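(* Let $(E,A)$ be a system with domain $M$ and codomain $V$, with defects $\alpha_k,\beta^+_k,\beta^-_k$ ($k\ge 1$) and dynamical dimension $\delta$. Then $$\dim M=\delta+\sum_{k\ge1}k\,\alpha_k+\sum_{k\ge1}k\,\beta^-_k+\sum_{k\ge1}k\,\beta^+_{k+1},$$ $$\dim V=\delta+\sum_{k\ge1}k\,\alpha_k+\sum_{k\ge1}k\,\beta^+_k+\sum_{k\ge1}k\,\beta^-_{k+1}.$$
   Context: Fix a field $\mathbb K$. A system $(E,A)$ is a pair of $\mathbb K$-linear maps $E,A:M\to V$ with the same finite-dimensional domain $M$ and the same finite-dimensional codomain $V$. Reduction: put $V'=EM$ and $M'=A^{-1}V'=\{x\in M: Ax\in V'\}$. Then $E$ and $A$ map $M'$ into $V'$; let $E',A':M'\to V'$ be the restrictions. The reduced system is $(E,A)'=(E',A')$. Define $(E^{(0)},A^{(0)})=(E,A)$ and $(E^{(k+1)},A^{(k+1)})=(E^{(k)},A^{(k)})'$, with domain $M^{(k)}$ and codomain $V^{(k)}$ of $(E^{(k)},A^{(k)})$; so $M''=M^{(2)}$, $V''=V^{(2)}=EM'$, etc. The index $n$ of $(E,A)$ is the smallest integer $n\ge 0$ with $(E^{(n+1)},A^{(n+1)})=(E^{(n)},A^{(n)})$ (it always exists), and $(E^{(\infty)},A^{(\infty)}):=(E^{(n)},A^{(n)})$, with domain $M^{(\infty)}$ and codomain $V^{(\infty)}$. Defects: let $[A]:M/M'\to V/V'$ and $[E]:M/M'\to V'/V''$ be the maps induced by $A$ and $E$ on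 the quotients. Put $\beta_1^+(E,A)=\dim\operatorname{coker}[A]$, $\alpha_1(E,A)=\dim\ker[E]$, and for $k\ge1$, $\alpha_k(E,A)=\alpha_1(E^{(k-1)},A^{(k-1)})$, $\beta^+_k(E,A)=\beta^+_1(E^{(k-1)},A^{(k-1)})$. The dual system of $(E,A)$ is the pair of adjoint (transpose) maps $(E^*,A^* )$, $E^*,A^*:V^*\to M^*$. Write $(E^{(\infty)*},A^{(\infty)*})$ for the dual of $(E^{(\infty)},A^{(\infty)})$. For $k\ge1$, $\beta^-_k(E,A):=\beta^+_k(E^{(\infty)*},A^{(\infty)*})$. Applying the total reduction $(\cdot)^{(\infty)}$ to $(E^{(\infty)*},A^{(\infty)*})$ gives the system $(E^{(\infty)*(\infty)},A^{(\infty)*(\infty)})$, whose domain and codomain have the same dimension; that common dimension is the dynamical dimension $\delta$. *)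

theory Defs
  imports "HOL-Algebra.AbelCoset" "Jordan_Normal_Form.Missing_VectorSpace"
begin

text \<open>
  The quotient \<open>V/W\<close> of a vector space by a subspace (given by its carrier), with the cosets
  of \<open>W\<close> as elements. Scalar multiplication is the coset of \<open>c \<odot> x\<close> for any representative \<open>x\<close>
  (for \<open>c = \<zero>\<close> the elementwise product would not be a coset). The ring fields \<open>mult\<close> and \<open>one\<close>
  of a module record carry no meaning.
\<close>

definition quotient_space :: "('k, 'v, 'c) module_scheme \<Rightarrow> 'v set \<Rightarrow> ('k, 'v set) module" where
  "quotient_space V W =
     \<lparr>carrier = a_rcosets\<^bsub>V\<^esub> W, mult = undefined, one = undefined,
      zero = W, add = (\<lambda>X Y. X <+>\<^bsub>V\<^esub> Y),
      smult = (\<lambda>c X. \<Union>x\<in>X. W +>\<^bsub>V\<^esub> (c \<odot>\<^bsub>V\<^esub> x))\<rparr>"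

text \<open>
  The map \<open>x + U \<mapsto> f x + W\<close> into \<open>V/W\<close> induced by \<open>f\<close>. All members \<open>x\<close> of a coset \<open>X\<close> of \<open>U\<close>
  yield the same coset \<open>W + f x\<close> whenever \<open>f\<close> maps \<open>U\<close> into \<open>W\<close>, so the union is that coset.
\<close>

definition induced_map :: "('k, 'v, 'c) module_scheme \<Rightarrow> 'v set \<Rightarrow> ('m \<Rightarrow> 'v) \<Rightarrow> 'm set \<Rightarrow> 'v set" where
  "induced_map V W f X = (\<Union>x\<in>X. W +>\<^bsub>V\<^esub> f x)"

definition ker_space ::
  "('k, 'm, 'c) module_scheme \<Rightarrow> ('k, 'v, 'd) module_scheme \<Rightarrow> ('m \<Rightarrow> 'v) \<Rightarrow> ('k, 'm, 'c) module_scheme" where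
  "ker_space M V f = M\<lparr>carrier := mod_hom.ker M V f\<rparr>"

definition coker_space ::
  "('k, 'm, 'c) module_scheme \<Rightarrow> ('k, 'v, 'd) module_scheme \<Rightarrow> ('m \<Rightarrow> 'v) \<Rightarrow> ('k, 'v set) module" where
  "coker_space M V f = quotient_space V (mod_hom.im M f)"

definition scalar_space :: "('k, 'c) ring_scheme \<Rightarrow> ('k, 'k) module" where
  "scalar_space K = \<lparr>carrier = carrier K, mult = mult K, one = one K, zero = zero K,
     add = add K, smult = mult K\<rparr>"

text \<open>
  Linear functionals are made unique as HOL functions by being \<open>undefined\<close> outside \<open>carrier V\<close>;
  \<open>ring.func_space\<close> supplies the pointwise operations on such functions.
\<close>

definition dual_space :: "('k, 'c) ring_scheme \<Rightarrow> ('k, 'v, 'd) module_scheme \<Rightarrow> ('k, 'v \<Rightarrow> 'k) module" where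
  "dual_space K V = ring.func_space K (carrier V)
     \<lparr>carrier := module_hom K V (scalar_space K) \<inter> extensional (carrier V)\<rparr>"

definition adjoint :: "('k, 'm, 'c) module_scheme \<Rightarrow> ('m \<Rightarrow> 'v) \<Rightarrow> ('v \<Rightarrow> 'k) \<Rightarrow> 'm \<Rightarrow> 'k" where
  "adjoint M T f = restrict (\<lambda>x. f (T x)) (carrier M)"

record ('k, 'm, 'v) system =
  sdom :: "('k, 'm) module"
  scod :: "('k, 'v) module"
  mapE :: "'m \<Rightarrow> 'v"
  mapA :: "'m \<Rightarrow> 'v"

definition is_system :: "('k, 'c) ring_scheme \<Rightarrow> ('k, 'm, 'v) system \<Rightarrow> bool" where
  "is_system K S \<longleftrightarrow>
     linear_map K (sdom S) (scod S) (mapE S) \<and> linear_map K (sdom S) (scod S) (mapA S) \<and>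
     vectorspace.fin_dim K (sdom S) \<and> vectorspace.fin_dim K (scod S)"

text \<open>
  Only the values of \<open>mapE\<close> and \<open>mapA\<close> on the carrier of \<open>sdom\<close> matter. Restricting them to a
  subspace therefore leaves the HOL functions unchanged, and two iterated reductions of the same
  system are equal as records iff they have the same domain and codomain, i.e. iff they are equal
  as pairs of linear maps.
\<close>

definition reduced_system :: "('k, 'm, 'v) system \<Rightarrow> ('k, 'm, 'v) system" where
  "reduced_system S =
     (let V' = mapE S ` carrier (sdom S);
          M' = {x \<in> carrier (sdom S). mapA S x \<in> V'}
      in S\<lparr>sdom := (sdom S)\<lparr>carrier := M'\<rparr>, scod := (scod S)\<lparr>carrier := V'\<rparr>\<rparr>)"

definition system_index :: "('k, 'm, 'v) system \<Rightarrow> nat" where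
  "system_index S = (LEAST n. (reduced_system ^^ (n + 1)) S = (reduced_system ^^ n) S)"

definition total_reduction :: "('k, 'm, 'v) system \<Rightarrow> ('k, 'm, 'v) system" where
  "total_reduction S = (reduced_system ^^ system_index S) S"

definition dual_system :: "('k, 'c) ring_scheme \<Rightarrow> ('k, 'm, 'v) system \<Rightarrow> ('k, 'v \<Rightarrow> 'k, 'm \<Rightarrow> 'k) system" where
  "dual_system K S =
     \<lparr>sdom = dual_space K (scod S), scod = dual_space K (sdom S),
      mapE = adjoint (sdom S) (mapE S), mapA = adjoint (sdom S) (mapA S)\<rparr>"

text \<open>\<open>[A] : M/M' \<rightarrow> V/V'\<close> and \<open>[E] : M/M' \<rightarrow> V'/V''\<close>.\<close>

definition beta1_plus :: "('k, 'c) ring_scheme \<Rightarrow> ('k, 'm, 'v) system \<Rightarrow> nat" where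
  "beta1_plus K S =
     (let M = sdom S; M' = sdom (reduced_system S); V = scod S; V' = scod (reduced_system S)
      in vectorspace.dim K
           (coker_space (quotient_space M (carrier M')) (quotient_space V (carrier V'))
              (induced_map V (carrier V') (mapA S))))"

definition alpha1 :: "('k, 'c) ring_scheme \<Rightarrow> ('k, 'm, 'v) system \<Rightarrow> nat" where
  "alpha1 K S =
     (let M = sdom S; M' = sdom (reduced_system S); V' = scod (reduced_system S); V'' = scod (reduced_system (reduced_system S))
      in vectorspace.dim K
           (ker_space (quotient_space M (carrier M')) (quotient_space V' (carrier V''))
              (induced_map V' (carrier V'') (mapE S))))"

text \<open>The defects are meaningful for \<open>k \<ge> 1\<close> only.\<close>

definition alpha :: "('k, 'c) ring_scheme \<Rightarrow> ('k, 'm, 'v) system \<Rightarrow> nat \<Rightarrow> nat" where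
  "alpha K S k = alpha1 K ((reduced_system ^^ (k - 1)) S)"

definition beta_plus :: "('k, 'c) ring_scheme \<Rightarrow> ('k, 'm, 'v) system \<Rightarrow> nat \<Rightarrow> nat" where
  "beta_plus K S k = beta1_plus K ((reduced_system ^^ (k - 1)) S)"

definition beta_minus :: "('k, 'c) ring_scheme \<Rightarrow> ('k, 'm, 'v) system \<Rightarrow> nat \<Rightarrow> nat" where
  "beta_minus K S k = beta_plus K (dual_system K (total_reduction S)) k"

text \<open>
  The domain and codomain of the system below have equal dimension; we read off the domain's.
\<close>

definition dynamical_dim :: "('k, 'c) ring_scheme \<Rightarrow> ('k, 'm, 'v) system \<Rightarrow> nat" where
  "dynamical_dim K S =
     vectorspace.dim K (sdom (total_reduction (dual_system K (total_reduction S))))"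

end

theory Submission
  imports Defs
begin

text \<open>
  Put \<open>m\<^sub>k = dim M\<^sup>k\<close> and \<open>v\<^sub>k = dim V\<^sup>k\<close> for the \<open>k\<close>-th reduced system. Since \<open>[A]\<close> is injective and
  \<open>[E]\<close> is surjective, rank-nullity gives \<open>\<beta>\<^sup>+\<^sub>k = (v\<^sub>k\<^sub>-\<^sub>1 - v\<^sub>k) - (m\<^sub>k\<^sub>-\<^sub>1 - m\<^sub>k)\<close> and
  \<open>\<alpha>\<^sub>k = (m\<^sub>k\<^sub>-\<^sub>1 - m\<^sub>k) - (v\<^sub>k - v\<^sub>k\<^sub>+\<^sub>1)\<close>. So \<open>\<alpha>\<^sub>k + \<beta>\<^sup>+\<^sub>k\<^sub>+\<^sub>1\<close> and \<open>\<alpha>\<^sub>k + \<beta>\<^sup>+\<^sub>k\<close> are the second differences of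
  \<open>m\<close> and \<open>v\<close>, and summation by parts expresses \<open>m\<^sub>0\<close> and \<open>v\<^sub>0\<close> through the limits of the two sequences.
  The totally reduced system has surjective \<open>E\<close>, hence its dual has injective \<open>E\<close>; all \<open>\<alpha>\<^sub>k\<close> of the dual
  vanish and its total reduction has \<open>E\<close> bijective. Applying the same formulas to the dual, whose
  domain and codomain have the limit dimensions of \<open>v\<close> and \<open>m\<close>, yields the result.
\<close>

section \<open>Subspaces and quotient spaces\<close>

lemma subspaceI:
  assumes "vectorspace K V" and "W \<subseteq> carrier V" and "\<zero>\<^bsub>V\<^esub> \<in> W"
    and "\<And>v w. v \<in> W \<Longrightarrow> w \<in> W \<Longrightarrow> v \<oplus>\<^bsub>V\<^esub> w \<in> W"
    and "\<And>c v. c \<in> carrier K \<Longrightarrow> v \<in> W \<Longrightarrow> c \<odot>\<^bsub>V\<^esub> v \<in> W"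
  shows "subspace K W V"
  using assms unfolding subspace_def submodule_def vectorspace_def by blast

lemma linear_mapI:
  assumes "vectorspace K V" and "vectorspace K W" and "f \<in> carrier V \<rightarrow> carrier W"
    and "\<And>x y. x \<in> carrier V \<Longrightarrow> y \<in> carrier V \<Longrightarrow> f (x \<oplus>\<^bsub>V\<^esub> y) = f x \<oplus>\<^bsub>W\<^esub> f y"
    and "\<And>c x. c \<in> carrier K \<Longrightarrow> x \<in> carrier V \<Longrightarrow> f (c \<odot>\<^bsub>V\<^esub> x) = c \<odot>\<^bsub>W\<^esub> f x"
  shows "linear_map K V W f"
  using assms
  unfolding linear_map_def mod_hom_def mod_hom_axioms_def module_hom_def vectorspace_def by auto

text \<open>A subset independent in \<open>W\<close> is independent in \<open>V\<close>, so it has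
  at most \<open>dim\<close> elements; a maximal one is a finite basis of \<open>W\<close>.\<close>

lemma (in vectorspace) fin_dim_subspace:
  assumes "fin_dim" and W: "subspace K W V"
  shows "vectorspace.fin_dim K (vs W)"
proof -
  interpret W: vectorspace K "vs W" using W by (rule subspace_is_vs)
  have sub: "submodule K W V" using W by simp
  have WV: "W \<subseteq> carrier V" using sub by (rule submodule.subset)
  have bound: "finite A \<and> card A \<le> dim" if "A \<subseteq> carrier (vs W) \<and> W.lin_indpt A" for A
  proof -
    have A: "A \<subseteq> W" using that by simp
    have "lin_indpt A" using that span_li_not_depend(2)[OF A sub] by simp
    then show ?thesis using li_le_dim[OF \<open>fin_dim\<close>, of A] A WV by blast
  qed
  have empty: "{} \<subseteq> carrier (vs W) \<and> W.lin_indpt {}"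
    by (simp add: W.lin_dep_def)
  obtain A where "finite A" "maximal A (\<lambda>S. S \<subseteq> carrier (vs W) \<and> W.lin_indpt S)"
    using maximal_exists[where P = "\<lambda>A. A \<subseteq> carrier (vs W) \<and> W.lin_indpt A" and N = dim, OF bound empty]
    by blast
  then show ?thesis
    using W.max_li_is_basis[of A] unfolding W.fin_dim_def W.basis_def by blast
qed

lemma (in vectorspace) dim_0_imp_carrier:
  assumes "fin_dim" and "dim = 0"
  shows "carrier V = {\<zero>\<^bsub>V\<^esub>}"
proof -
  obtain B where "finite B" "basis B" using finite_basis_exists \<open>fin_dim\<close> by blast
  then have "B = {}" using dim_basis[of B] \<open>dim = 0\<close> by simp
  then show ?thesis using \<open>basis B\<close> span_empty unfolding basis_def by simp
qed

text \<open>\<open>Q\<close> starts as a mere record: it inherits the vector space axioms through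
  the surjection \<open>f\<close>, which respects the operations. For quotients this reduces
  everything to representatives.\<close>

lemma vectorspace_surj_image:
  assumes V: "vectorspace K V" and surj: "f ` carrier V = carrier Q"
    and add: "\<And>x y. x \<in> carrier V \<Longrightarrow> y \<in> carrier V \<Longrightarrow> f x \<oplus>\<^bsub>Q\<^esub> f y = f (x \<oplus>\<^bsub>V\<^esub> y)"
    and smult: "\<And>c x. c \<in> carrier K \<Longrightarrow> x \<in> carrier V \<Longrightarrow> c \<odot>\<^bsub>Q\<^esub> f x = f (c \<odot>\<^bsub>V\<^esub> x)"
    and zero: "\<zero>\<^bsub>Q\<^esub> = f \<zero>\<^bsub>V\<^esub>"
  shows "vectorspace K Q" and "linear_map K V Q f"
proof -
  interpret V: vectorspace K V by (rule V)
  show Q: "vectorspace K Q"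
  proof (rule vs_criteria)
    show "\<forall>v\<in>carrier Q. \<exists>neg_v\<in>carrier Q. v \<oplus>\<^bsub>Q\<^esub> neg_v = \<zero>\<^bsub>Q\<^esub>"
    proof
      fix v assume "v \<in> carrier Q"
      then obtain x where x: "x \<in> carrier V" "v = f x" using surj by blast
      then have "v \<oplus>\<^bsub>Q\<^esub> f (\<ominus>\<^bsub>V\<^esub> x) = \<zero>\<^bsub>Q\<^esub>" by (simp add: add zero V.M.r_neg)
      moreover have "f (\<ominus>\<^bsub>V\<^esub> x) \<in> carrier Q" using x surj V.M.a_inv_closed by blast
      ultimately show "\<exists>neg_v\<in>carrier Q. v \<oplus>\<^bsub>Q\<^esub> neg_v = \<zero>\<^bsub>Q\<^esub>" by blast
    qed
  qed (auto simp flip: surj simp: add smult zero V.M.a_ac V.smult_assoc1 V.smult_l_distr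
      V.smult_r_distr V.field_axioms)
  show "linear_map K V Q f"
    using surj by (intro linear_mapI V Q) (auto simp: add smult)
qed

text \<open>Serves to turn an isomorphism around, so that it leads from the space of known dimension
  to the other one.\<close>

lemma (in linear_map) inv_into_linear:
  assumes bij: "bij_betw T (carrier V) (carrier W)"
  shows "linear_map K W V (inv_into (carrier V) T)"
proof (rule linear_mapI)
  let ?S = "inv_into (carrier V) T"
  have S: "?S y \<in> carrier V" "T (?S y) = y" if "y \<in> carrier W" for y
    using bij that by (auto simp: bij_betw_def f_inv_into_f intro: inv_into_into)
  have ST: "?S (T x) = x" if "x \<in> carrier V" for x
    using bij that by (simp add: bij_betw_def)
  show "?S \<in> carrier W \<rightarrow> carrier V" using S by blast
  show "?S (x \<oplus>\<^bsub>W\<^esub> y) = ?S x \<oplus>\<^bsub>V\<^esub> ?S y" if "x \<in> carrier W" "y \<in> carrier W" for x y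
    using ST[of "?S x \<oplus>\<^bsub>V\<^esub> ?S y"] S that by simp
  show "?S (c \<odot>\<^bsub>W\<^esub> x) = c \<odot>\<^bsub>V\<^esub> ?S x" if "c \<in> carrier K" "x \<in> carrier W" for c x
    using ST[of "c \<odot>\<^bsub>V\<^esub> ?S x"] S that by simp
qed unfold_locales

section \<open>Quotients by a subspace and their dimension\<close>

context
  fixes K :: "('k, 'c) ring_scheme" and V :: "('k, 'v, 'd) module_scheme" and W :: "'v set"
  assumes W: "subspace K W V"
begin

interpretation V: vectorspace K V using W by (rule subspace.vs)
interpretation Wsub: submodule K W V using W by (rule subspace.submod)

text \<open>Negation is scalar multiplication by minus one, so \<open>W\<close> is closed under it.
  This opens the coset calculus of abelian groups.\<close>

lemma subspace_abelian_subgroup: "abelian_subgroup W V"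
proof (rule abelian_subgroupI3)
  show "additive_subgroup W V"
  proof (rule additive_subgroupI, rule V.M.add.subgroupI)
    show "\<ominus>\<^bsub>V\<^esub> a \<in> W" if "a \<in> W" for a
      using that Wsub.subset by (subst V.smult_minus_1[symmetric]) auto
    show "W \<noteq> {}" using Wsub.zero_closed by blast
  qed (use Wsub.subset in auto)
qed unfold_locales

interpretation ab: abelian_subgroup W V by (rule subspace_abelian_subgroup)

lemma quotient_space_simps:
  "carrier (quotient_space V W) = (\<lambda>x. W +>\<^bsub>V\<^esub> x) ` carrier V"
  "\<zero>\<^bsub>quotient_space V W\<^esub> = W"
  "X \<oplus>\<^bsub>quotient_space V W\<^esub> Y = X <+>\<^bsub>V\<^esub> Y"
  "c \<odot>\<^bsub>quotient_space V W\<^esub> X = (\<Union>x\<in>X. W +>\<^bsub>V\<^esub> (c \<odot>\<^bsub>V\<^esub> x))"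
  by (auto simp: quotient_space_def A_RCOSETS_def' image_def)

text \<open>Scalar multiplication on the quotient and \<open>induced_map\<close> are unions over a
  coset. If moving \<open>x\<close> by elements of \<open>W\<close> does not change
  \<open>F\<close>, the union is over a nonempty constant family.\<close>

lemma UN_coset:
  assumes "x \<in> carrier V" and "\<And>w. w \<in> W \<Longrightarrow> F (w \<oplus>\<^bsub>V\<^esub> x) = F x"
  shows "(\<Union>y\<in>W +>\<^bsub>V\<^esub> x. F y) = F x"
proof -
  have "F y = F x" if "y \<in> W +>\<^bsub>V\<^esub> x" for y
    using that assms(2) by (auto simp: a_r_coset_def')
  then show ?thesis using ab.a_rcos_self[OF assms(1)] by blast
qed

lemma coset_add_left:
  assumes "w \<in> W" "x \<in> carrier V"
  shows "W +>\<^bsub>V\<^esub> (w \<oplus>\<^bsub>V\<^esub> x) = W +>\<^bsub>V\<^esub> x"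
  using V.M.a_repr_independence[of "w \<oplus>\<^bsub>V\<^esub> x" W x] V.M.a_rcosI[of w W x] assms Wsub.subset
    ab.a_subgroup by simp

lemma coset_eq_subspace_iff:
  assumes "x \<in> carrier V"
  shows "W +>\<^bsub>V\<^esub> x = W \<longleftrightarrow> x \<in> W"
  using ab.a_rcos_self[OF assms] V.M.a_coset_join2[OF assms ab.a_subgroup] by auto

lemma quotient_space_vectorspace: "vectorspace K (quotient_space V W)"
  and quotient_proj_linear: "linear_map K V (quotient_space V W) (\<lambda>x. W +>\<^bsub>V\<^esub> x)"
proof -
  have smult: "c \<odot>\<^bsub>quotient_space V W\<^esub> (W +>\<^bsub>V\<^esub> x) = W +>\<^bsub>V\<^esub> (c \<odot>\<^bsub>V\<^esub> x)"
    if "c \<in> carrier K" "x \<in> carrier V" for c x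
    unfolding quotient_space_simps
  proof (rule UN_coset)
    fix w assume "w \<in> W"
    then show "W +>\<^bsub>V\<^esub> (c \<odot>\<^bsub>V\<^esub> (w \<oplus>\<^bsub>V\<^esub> x)) = W +>\<^bsub>V\<^esub> (c \<odot>\<^bsub>V\<^esub> x)"
      using that Wsub.subset coset_add_left[of "c \<odot>\<^bsub>V\<^esub> w" "c \<odot>\<^bsub>V\<^esub> x"]
      by (auto simp: V.smult_r_distr)
  qed (rule that)
  have zero: "\<zero>\<^bsub>quotient_space V W\<^esub> = W +>\<^bsub>V\<^esub> \<zero>\<^bsub>V\<^esub>"
    using coset_eq_subspace_iff[of "\<zero>\<^bsub>V\<^esub>"] by (simp add: quotient_space_simps)
  \<comment> \<open>The underscore leaves compatibility with addition open;
    \<open>ab.a_rcos_sum\<close> settles it below.\<close>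
  note * = V.vectorspace_axioms quotient_space_simps(1)[symmetric] _ smult zero
  show "vectorspace K (quotient_space V W)"
    by (rule vectorspace_surj_image(1)[OF *]) (simp_all add: quotient_space_simps ab.a_rcos_sum)
  show "linear_map K V (quotient_space V W) (\<lambda>x. W +>\<^bsub>V\<^esub> x)"
    by (rule vectorspace_surj_image(2)[OF *]) (simp_all add: quotient_space_simps ab.a_rcos_sum)
qed

lemma fin_dim_quotient:
  assumes "V.fin_dim"
  shows "vectorspace.fin_dim K (quotient_space V W)"
proof -
  interpret P: linear_map K V "quotient_space V W" "\<lambda>x. W +>\<^bsub>V\<^esub> x"
    by (rule quotient_proj_linear)
  show ?thesis using P.surj_fin_dim assms by (simp add: quotient_space_simps)
qed

text \<open>Rank-nullity for the projection, whose kernel is \<open>W\<close>.\<close>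

lemma dim_quotient:
  assumes "V.fin_dim"
  shows "vectorspace.dim K (quotient_space V W) + vectorspace.dim K (V\<lparr>carrier := W\<rparr>) = V.dim"
proof -
  interpret P: linear_map K V "quotient_space V W" "\<lambda>x. W +>\<^bsub>V\<^esub> x"
    by (rule quotient_proj_linear)
  have "P.ker = W"
    using coset_eq_subspace_iff Wsub.subset by (auto simp: P.ker_def quotient_space_simps)
  moreover have "P.im = carrier (quotient_space V W)"
    by (simp add: P.im_def quotient_space_simps)
  ultimately show ?thesis using P.rank_nullity[OF assms] by simp
qed

lemma dim_subspace_le:
  assumes "V.fin_dim"
  shows "vectorspace.dim K (V\<lparr>carrier := W\<rparr>) \<le> V.dim"
  using dim_quotient[OF assms] by simp

text \<open>The quotient has dimension zero, so \<open>W\<close> is its only coset and contains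
  every vector.\<close>

lemma subspace_eq_carrier:
  assumes "V.fin_dim" and "vectorspace.dim K (V\<lparr>carrier := W\<rparr>) = V.dim"
  shows "W = carrier V"
proof -
  interpret Q: vectorspace K "quotient_space V W" by (rule quotient_space_vectorspace)
  have "carrier (quotient_space V W) = {W}"
    using Q.dim_0_imp_carrier fin_dim_quotient[OF assms(1)] dim_quotient[OF assms(1)] assms(2)
    by (simp add: quotient_space_simps)
  then have "x \<in> W" if "x \<in> carrier V" for x
    using that coset_eq_subspace_iff[OF that] by (auto simp: quotient_space_simps)
  then show ?thesis using Wsub.subset by blast
qed

end

section \<open>Linear maps induced between quotients\<close>

context
  fixes K :: "('k, 'c) ring_scheme" and M :: "('k, 'm, 'd) module_scheme"
    and V :: "('k, 'v, 'e) module_scheme" and f :: "'m \<Rightarrow> 'v" and U :: "'m set" and W :: "'v set"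
  assumes f: "linear_map K M V f" and U: "subspace K U M" and W: "subspace K W V"
    and fUW: "\<And>x. x \<in> U \<Longrightarrow> f x \<in> W"
begin

interpretation f: linear_map K M V f by (rule f)

lemma induced_map_coset:
  assumes "x \<in> carrier M"
  shows "induced_map V W f (U +>\<^bsub>M\<^esub> x) = W +>\<^bsub>V\<^esub> f x"
  unfolding induced_map_def
proof (rule UN_coset[OF U assms])
  fix u assume "u \<in> U"
  then show "W +>\<^bsub>V\<^esub> f (u \<oplus>\<^bsub>M\<^esub> x) = W +>\<^bsub>V\<^esub> f x"
    using assms submodule.subset[OF subspace.submod[OF U]] coset_add_left[OF W fUW] by auto
qed

lemma induced_map_linear:
  "linear_map K (quotient_space M U) (quotient_space V W) (induced_map V W f)"
proof -
  interpret P: linear_map K M "quotient_space M U" "\<lambda>x. U +>\<^bsub>M\<^esub> x"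
    using U by (rule quotient_proj_linear)
  interpret R: linear_map K V "quotient_space V W" "\<lambda>x. W +>\<^bsub>V\<^esub> x"
    using W by (rule quotient_proj_linear)
  have car: "\<exists>x\<in>carrier M. X = U +>\<^bsub>M\<^esub> x" if "X \<in> carrier (quotient_space M U)" for X
    using that by (auto simp: quotient_space_simps[OF U])
  show ?thesis
  proof (rule linear_mapI)
    show "induced_map V W f \<in> carrier (quotient_space M U) \<rightarrow> carrier (quotient_space V W)"
      using car by (force simp: induced_map_coset)
    fix X Y assume "X \<in> carrier (quotient_space M U)" "Y \<in> carrier (quotient_space M U)"
    then obtain x y where xy: "x \<in> carrier M" "X = U +>\<^bsub>M\<^esub> x" "y \<in> carrier M" "Y = U +>\<^bsub>M\<^esub> y"
      using car by metis
    then show "induced_map V W f (X \<oplus>\<^bsub>quotient_space M U\<^esub> Y)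
        = induced_map V W f X \<oplus>\<^bsub>quotient_space V W\<^esub> induced_map V W f Y"
      by (simp add: induced_map_coset flip: P.T_add R.T_add)
  next
    fix c X assume c: "c \<in> carrier K" and "X \<in> carrier (quotient_space M U)"
    then obtain x where "x \<in> carrier M" "X = U +>\<^bsub>M\<^esub> x" using car by metis
    with c show "induced_map V W f (c \<odot>\<^bsub>quotient_space M U\<^esub> X)
        = c \<odot>\<^bsub>quotient_space V W\<^esub> induced_map V W f X"
      by (simp add: induced_map_coset flip: P.T_smult R.T_smult)
  qed unfold_locales
qed

text \<open>By \<open>inj\<close> the preimage of \<open>W\<close> lies in \<open>U\<close>, so the
  induced map is injective and its image has the dimension of \<open>M/U\<close>. The additive form
  avoids subtraction on naturals.\<close>

lemma dim_coker_induced_map: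
  assumes "vectorspace.fin_dim K M" and "vectorspace.fin_dim K V"
    and inj: "\<And>x. x \<in> carrier M \<Longrightarrow> f x \<in> W \<Longrightarrow> x \<in> U"
  shows "vectorspace.dim K (coker_space (quotient_space M U) (quotient_space V W) (induced_map V W f))
      + vectorspace.dim K (quotient_space M U) = vectorspace.dim K (quotient_space V W)"
proof -
  interpret I: linear_map K "quotient_space M U" "quotient_space V W" "induced_map V W f"
    by (rule induced_map_linear)
  \<comment> \<open>\<open>U\<close> and \<open>W\<close> are the zeros of the two quotients, so
    this is triviality of the kernel.\<close>
  have "X = U" if X: "X \<in> carrier (quotient_space M U)" "induced_map V W f X = W" for X
  proof -
    obtain x where x: "x \<in> carrier M" "X = U +>\<^bsub>M\<^esub> x"
      using X(1) by (auto simp: quotient_space_simps[OF U])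
    then have "f x \<in> W"
      using X(2) by (simp add: induced_map_coset coset_eq_subspace_iff[OF W])
    then show ?thesis
      using x inj by (simp add: coset_eq_subspace_iff[OF U])
  qed
  moreover have "U \<in> carrier (quotient_space M U)" and "induced_map V W f U = W"
    using I.V.module.M.zero_closed I.T0_is_0
    unfolding quotient_space_simps(2)[OF U] quotient_space_simps(2)[OF W] by blast+
  ultimately have "carrier (I.V.vs I.kerT) = {\<zero>\<^bsub>quotient_space M U\<^esub>}"
    unfolding I.V.carrier_vs_is_self I.ker_def quotient_space_simps(2)[OF U] quotient_space_simps(2)[OF W]
    by blast
  then have "inj_on (induced_map V W f) (carrier (quotient_space M U))"
    by (rule I.Ke0_imp_inj)
  then have "vectorspace.dim K (I.V.vs I.kerT) = 0"
    by (rule I.inj_imp_dim_ker0)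
  then show ?thesis
    using I.rank_nullity[OF fin_dim_quotient[OF U assms(1)]]
      dim_quotient[OF I.imT_is_subspace fin_dim_quotient[OF W assms(2)]]
    by (simp add: coker_space_def)
qed

text \<open>Surjectivity passes from \<open>f\<close> to the induced map, and rank-nullity gives the
  kernel.\<close>

lemma dim_ker_induced_map:
  assumes "vectorspace.fin_dim K M" and surj: "f ` carrier M = carrier V"
  shows "vectorspace.dim K (ker_space (quotient_space M U) (quotient_space V W) (induced_map V W f))
      + vectorspace.dim K (quotient_space V W) = vectorspace.dim K (quotient_space M U)"
proof -
  interpret I: linear_map K "quotient_space M U" "quotient_space V W" "induced_map V W f"
    by (rule induced_map_linear)
  have "I.im = carrier (quotient_space V W)"
    unfolding I.im_def quotient_space_simps[OF U] quotient_space_simps[OF W] surj[symmetric] image_image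
    by (rule image_cong) (simp_all add: induced_map_coset)
  then show ?thesis
    using I.rank_nullity[OF fin_dim_quotient[OF U assms(1)]] by (simp add: ker_space_def)
qed

end

section \<open>Dual spaces\<close>

lemma (in field) scalar_space_vectorspace: "vectorspace R (scalar_space R)"
proof (rule vs_criteria)
  show "\<forall>v\<in>carrier (scalar_space R). \<exists>w\<in>carrier (scalar_space R). v \<oplus>\<^bsub>scalar_space R\<^esub> w = \<zero>\<^bsub>scalar_space R\<^esub>"
    by (auto simp: scalar_space_def intro!: bexI[of _ "\<ominus> _"] r_neg)
qed (auto simp: scalar_space_def field_axioms a_ac m_assoc l_distr r_distr)

context vectorspace
begin

lemma dual_space_simps:
  "carrier (dual_space K V) = module_hom K V (scalar_space K) \<inter> extensional (carrier V)"
  "\<zero>\<^bsub>dual_space K V\<^esub> = (\<lambda>v\<in>carrier V. \<zero>\<^bsub>K\<^esub>)"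
  "f \<oplus>\<^bsub>dual_space K V\<^esub> g = (\<lambda>v\<in>carrier V. f v \<oplus>\<^bsub>K\<^esub> g v)"
  "c \<odot>\<^bsub>dual_space K V\<^esub> f = (\<lambda>v\<in>carrier V. c \<otimes>\<^bsub>K\<^esub> f v)"
  by (simp_all add: dual_space_def func_space_def)

lemma func_space_simps:
  "carrier (func_space S) = S \<rightarrow>\<^sub>E carrier K"
  "\<zero>\<^bsub>func_space S\<^esub> = (\<lambda>v\<in>S. \<zero>\<^bsub>K\<^esub>)"
  "f \<oplus>\<^bsub>func_space S\<^esub> g = (\<lambda>v\<in>S. f v \<oplus>\<^bsub>K\<^esub> g v)"
  "c \<odot>\<^bsub>func_space S\<^esub> f = (\<lambda>v\<in>S. c \<otimes>\<^bsub>K\<^esub> f v)"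
  by (simp_all add: func_space_def)

lemma dual_space_carrier_iff:
  "f \<in> carrier (dual_space K V) \<longleftrightarrow>
    f \<in> carrier V \<rightarrow>\<^sub>E carrier K \<and>
    (\<forall>x\<in>carrier V. \<forall>y\<in>carrier V. f (x \<oplus>\<^bsub>V\<^esub> y) = f x \<oplus>\<^bsub>K\<^esub> f y) \<and>
    (\<forall>c\<in>carrier K. \<forall>x\<in>carrier V. f (c \<odot>\<^bsub>V\<^esub> x) = c \<otimes>\<^bsub>K\<^esub> f x)"
  by (auto simp: dual_space_simps module_hom_def scalar_space_def PiE_def)

lemma dual_space_closed:
  "f \<in> carrier (dual_space K V) \<Longrightarrow> x \<in> carrier V \<Longrightarrow> f x \<in> carrier K"
  by (auto simp: dual_space_carrier_iff)

text \<open>The functionals form a subspace of the space of all functions on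
  \<open>carrier V\<close>; \<open>dual_space\<close> only replaces the carrier.\<close>

lemma dual_space_vectorspace: "vectorspace K (dual_space K V)"
proof -
  interpret F: vectorspace K "func_space (carrier V)" by (rule func_space_is_vs)
  have "subspace K (carrier (dual_space K V)) (func_space (carrier V))"
  proof (rule subspaceI)
    show "carrier (dual_space K V) \<subseteq> carrier (func_space (carrier V))"
      by (auto simp: dual_space_carrier_iff func_space_simps)
  next
    show "\<zero>\<^bsub>func_space (carrier V)\<^esub> \<in> carrier (dual_space K V)"
      by (auto simp: dual_space_carrier_iff func_space_simps)
  next
    fix f g assume f: "f \<in> carrier (dual_space K V)" and g: "g \<in> carrier (dual_space K V)"
    show "f \<oplus>\<^bsub>func_space (carrier V)\<^esub> g \<in> carrier (dual_space K V)"
      using f g dual_space_closed[OF f] dual_space_closed[OF g]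
      by (simp add: dual_space_carrier_iff func_space_simps R.a_ac R.r_distr)
  next
    fix c f assume c: "c \<in> carrier K" and f: "f \<in> carrier (dual_space K V)"
    show "c \<odot>\<^bsub>func_space (carrier V)\<^esub> f \<in> carrier (dual_space K V)"
      using c f dual_space_closed[OF f] by (simp add: dual_space_carrier_iff func_space_simps R.r_distr R.m_lcomm)
  qed unfold_locales
  from F.subspace_is_vs[OF this] show ?thesis
    by (simp add: dual_space_def)
qed

lemma lincomb_delta:
  assumes "finite B" "B \<subseteq> carrier V" "b \<in> B"
  shows "lincomb (\<lambda>b'. if b = b' then \<one>\<^bsub>K\<^esub> else \<zero>\<^bsub>K\<^esub>) B = b"
proof -
  have "lincomb (\<lambda>b'. if b = b' then \<one>\<^bsub>K\<^esub> else \<zero>\<^bsub>K\<^esub>) B = (\<Oplus>\<^bsub>V\<^esub>b'\<in>B. if b = b' then b' else \<zero>\<^bsub>V\<^esub>)"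
    unfolding lincomb_def using assms by (intro M.finsum_cong') auto
  also have "\<dots> = b" using assms by (intro M.add.finprod_singleton) auto
  finally show ?thesis .
qed

text \<open>A functional is determined by its values on a basis \<open>B\<close>, and these can be
  prescribed freely. So \<open>V\<close> and its dual are both isomorphic to
  \<open>func_space B\<close>, by coordinates and by restriction to \<open>B\<close>.\<close>

lemma dual_space_fin_dim: "fin_dim \<Longrightarrow> vectorspace.fin_dim K (dual_space K V)"
  and dual_space_dim: "fin_dim \<Longrightarrow> vectorspace.dim K (dual_space K V) = dim"
proof -
  assume fd: "fin_dim"
  then obtain B where B: "finite B" "basis B" using finite_basis_exists by blast
  then have BV: "B \<subseteq> carrier V" and gen: "gen_set B" by (auto simp: basis_def)
  interpret D: vectorspace K "dual_space K V" by (rule dual_space_vectorspace)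
  interpret L: linear_map K "func_space B" V "\<lambda>a. lincomb a B"
    using B(1) BV by (rule lincomb_is_linear)
  have coord: "\<exists>!a. a \<in> carrier (func_space B) \<and> lincomb a B = v" if "v \<in> carrier V" for v
    using basis_criterion[OF B(1) BV] B(2) that unfolding func_space_simps by blast
  have bijL: "bij_betw (\<lambda>a. lincomb a B) (carrier (func_space B)) (carrier V)"
    unfolding bij_betw_def
  proof
    show "inj_on (\<lambda>a. lincomb a B) (carrier (func_space B))"
      using coord[OF L.T_im] by (intro inj_onI) metis
    show "(\<lambda>a. lincomb a B) ` carrier (func_space B) = carrier V"
      using coord L.T_im by (safe; metis imageI)
  qed
  \<comment> \<open>\<open>C\<close> sends a vector to its coordinates with respect to
    \<open>B\<close>.\<close>
  define C where "C = inv_into (carrier (func_space B)) (\<lambda>a. lincomb a B)"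
  interpret C: linear_map K V "func_space B" C
    unfolding C_def using bijL by (rule L.inv_into_linear)
  have bijC: "bij_betw C (carrier V) (carrier (func_space B))"
    unfolding C_def using bijL by (rule bij_betw_inv_into)
  have fdF: "L.V.fin_dim" and dimF: "L.V.dim = dim"
    using C.surj_fin_dim[OF fd] C.dim_eq[OF fd] bijC by (auto simp: bij_betw_def)
  have C_mem: "C v b \<in> carrier K" if "v \<in> carrier V" "b \<in> B" for v b
    using C.T_im[OF that(1)] that(2) by (auto simp: func_space_simps)
  have C_basis: "C b = (\<lambda>b'\<in>B. if b = b' then \<one>\<^bsub>K\<^esub> else \<zero>\<^bsub>K\<^esub>)" if "b \<in> B" for b
  proof -
    let ?d = "\<lambda>b'\<in>B. if b = b' then \<one>\<^bsub>K\<^esub> else \<zero>\<^bsub>K\<^esub>"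
    have "lincomb ?d B = lincomb (\<lambda>b'. if b = b' then \<one>\<^bsub>K\<^esub> else \<zero>\<^bsub>K\<^esub>) B"
      using BV by (intro lincomb_cong) auto
    then have "lincomb ?d B = b" using lincomb_delta[OF B(1) BV that] by simp
    moreover have "?d \<in> carrier (func_space B)" by (auto simp: func_space_simps)
    ultimately show ?thesis
      unfolding C_def using bijL by (metis (no_types, lifting) bij_betw_def inv_into_f_f)
  qed
  interpret Res: linear_map K "dual_space K V" "func_space B" "\<lambda>f. restrict f B"
  proof (rule linear_mapI)
    show "(\<lambda>f. restrict f B) \<in> carrier (dual_space K V) \<rightarrow> carrier (func_space B)"
      using BV dual_space_closed by (auto simp: func_space_simps)
  qed (use BV in \<open>unfold_locales, auto simp: func_space_simps dual_space_simps fun_eq_iff subset_iff\<close>)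
  have inj: "inj_on (\<lambda>f. restrict f B) (carrier (dual_space K V))"
  proof (rule inj_onI)
    fix f g
    assume f: "f \<in> carrier (dual_space K V)" and g: "g \<in> carrier (dual_space K V)"
      and eq: "restrict f B = restrict g B"
    interpret S: vectorspace K "scalar_space K" by (rule scalar_space_vectorspace)
    interpret f: linear_map K V "scalar_space K" f
      using f by unfold_locales (simp add: dual_space_simps)
    interpret g: linear_map K V "scalar_space K" g
      using g by unfold_locales (simp add: dual_space_simps)
    \<comment> \<open>The functionals agree on a subspace; since it contains the basis, it is
      everything.\<close>
    let ?N = "{v \<in> carrier V. f v = g v}"
    have "submodule K ?N V"
      by (intro submodule.intro) (auto, unfold_locales)
    moreover have "B \<subseteq> ?N"
      using BV eq by (auto simp: fun_eq_iff restrict_def) (metis subsetD)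
    ultimately have "carrier V \<subseteq> ?N"
      using span_is_subset gen by blast
    then show "f = g"
      using f g by (intro extensionalityI[of f "carrier V"]) (auto simp: dual_space_simps)
  qed
  have surj: "(\<lambda>f. restrict f B) ` carrier (dual_space K V) = carrier (func_space B)"
  proof
    show "(\<lambda>f. restrict f B) ` carrier (dual_space K V) \<subseteq> carrier (func_space B)"
      using Res.T_im by blast
    show "carrier (func_space B) \<subseteq> (\<lambda>f. restrict f B) ` carrier (dual_space K V)"
    proof
      fix g assume g: "g \<in> carrier (func_space B)"
      then have g_mem: "g b \<in> carrier K" if "b \<in> B" for b
        using that by (auto simp: func_space_simps)
      \<comment> \<open>The linear extension of \<open>g\<close>: the values prescribed on
        \<open>B\<close>, weighted by coordinates.\<close>
      define f where "f = (\<lambda>v\<in>carrier V. \<Oplus>\<^bsub>K\<^esub>b\<in>B. C v b \<otimes>\<^bsub>K\<^esub> g b)"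
      have "f (x \<oplus>\<^bsub>V\<^esub> y) = f x \<oplus>\<^bsub>K\<^esub> f y" if xy: "x \<in> carrier V" "y \<in> carrier V" for x y
      proof -
        have "f (x \<oplus>\<^bsub>V\<^esub> y) = (\<Oplus>\<^bsub>K\<^esub>b\<in>B. C (x \<oplus>\<^bsub>V\<^esub> y) b \<otimes>\<^bsub>K\<^esub> g b)"
          using xy by (simp add: f_def del: C.T_add)
        also have "\<dots> = (\<Oplus>\<^bsub>K\<^esub>b\<in>B. C x b \<otimes>\<^bsub>K\<^esub> g b \<oplus>\<^bsub>K\<^esub> C y b \<otimes>\<^bsub>K\<^esub> g b)"
          using xy by (intro R.finsum_cong') (auto simp: func_space_simps C_mem g_mem R.l_distr)
        also have "\<dots> = f x \<oplus>\<^bsub>K\<^esub> f y"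
          using xy by (simp add: f_def R.finsum_addf C_mem g_mem)
        finally show ?thesis .
      qed
      moreover have "f (c \<odot>\<^bsub>V\<^esub> x) = c \<otimes>\<^bsub>K\<^esub> f x" if cx: "c \<in> carrier K" "x \<in> carrier V" for c x
      proof -
        have "f (c \<odot>\<^bsub>V\<^esub> x) = (\<Oplus>\<^bsub>K\<^esub>b\<in>B. C (c \<odot>\<^bsub>V\<^esub> x) b \<otimes>\<^bsub>K\<^esub> g b)"
          using cx by (simp add: f_def del: C.T_smult)
        also have "\<dots> = (\<Oplus>\<^bsub>K\<^esub>b\<in>B. c \<otimes>\<^bsub>K\<^esub> (C x b \<otimes>\<^bsub>K\<^esub> g b))"
          using cx by (intro R.finsum_cong') (auto simp: func_space_simps C_mem g_mem R.m_assoc)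
        also have "\<dots> = c \<otimes>\<^bsub>K\<^esub> f x"
          using cx B(1) by (simp add: f_def R.finsum_rdistr C_mem g_mem)
        finally show ?thesis .
      qed
      ultimately have "f \<in> carrier (dual_space K V)"
        by (auto simp: dual_space_carrier_iff f_def C_mem g_mem)
      moreover have "restrict f B = g"
      proof (rule extensionalityI[of _ B])
        fix b assume b: "b \<in> B"
        \<comment> \<open>The coordinates of a basis vector are Kronecker deltas, so one summand
          survives.\<close>
        have "f b = (\<Oplus>\<^bsub>K\<^esub>b'\<in>B. if b = b' then g b' else \<zero>\<^bsub>K\<^esub>)"
          using b BV by (auto simp: f_def C_basis g_mem intro!: R.finsum_cong')
        also have "\<dots> = g b"
          using b B(1) g_mem by (intro R.add.finprod_singleton) auto
        finally show "restrict f B b = g b" using b by simp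
      qed (use g in \<open>auto simp: func_space_simps PiE_def\<close>)
      ultimately show "g \<in> (\<lambda>f. restrict f B) ` carrier (dual_space K V)" by blast
    qed
  qed
  have bijR: "bij_betw (\<lambda>f. restrict f B) (carrier (dual_space K V)) (carrier (func_space B))"
    using inj surj by (simp add: bij_betw_def)
  \<comment> \<open>The inverse is taken because finite dimension, known for
    \<open>func_space B\<close>, passes from domain to codomain of a surjection.\<close>
  interpret I: linear_map K "func_space B" "dual_space K V"
      "inv_into (carrier (dual_space K V)) (\<lambda>f. restrict f B)"
    using bijR by (rule Res.inv_into_linear)
  have "bij_betw (inv_into (carrier (dual_space K V)) (\<lambda>f. restrict f B))
      (carrier (func_space B)) (carrier (dual_space K V))"
    using bijR by (rule bij_betw_inv_into)
  then show "D.fin_dim" and "D.dim = dim"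
    using I.surj_fin_dim[OF fdF] I.dim_eq[OF fdF] dimF by (auto simp: bij_betw_def)
qed

end

lemma (in linear_map) adjoint_linear:
  "linear_map K (dual_space K W) (dual_space K V) (adjoint V T)"
proof (rule linear_mapI)
  show "vectorspace K (dual_space K W)" by (rule W.dual_space_vectorspace)
  show "vectorspace K (dual_space K V)" by (rule V.dual_space_vectorspace)
  have "f (T x) \<in> carrier K" if "f \<in> carrier (dual_space K W)" "x \<in> carrier V" for f x
    using that by (simp add: W.dual_space_closed)
  then show "adjoint V T \<in> carrier (dual_space K W) \<rightarrow> carrier (dual_space K V)"
    by (auto simp: V.dual_space_carrier_iff W.dual_space_carrier_iff adjoint_def)
qed (auto simp: V.dual_space_simps W.dual_space_simps adjoint_def fun_eq_iff)

text \<open>A functional on \<open>W\<close> is determined by its composite with a surjection onto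
  \<open>W\<close>.\<close>

lemma (in linear_map) adjoint_inj:
  assumes surj: "T ` carrier V = carrier W"
  shows "inj_on (adjoint V T) (carrier (dual_space K W))"
proof (rule inj_onI)
  fix f g
  assume fg: "f \<in> carrier (dual_space K W)" "g \<in> carrier (dual_space K W)"
    and eq: "adjoint V T f = adjoint V T g"
  have "f (T x) = g (T x)" if "x \<in> carrier V" for x
    using fun_cong[OF eq, of x] that by (simp add: adjoint_def)
  then have "f y = g y" if "y \<in> carrier W" for y
    using that surj by (metis imageE)
  then show "f = g"
    using fg by (intro extensionalityI[of f "carrier W"]) (auto simp: W.dual_space_simps)
qed

section \<open>Reductions of systems\<close>

lemma reduced_system_simps:
  "sdom (reduced_system S) =
    (sdom S)\<lparr>carrier := {x \<in> carrier (sdom S). mapA S x \<in> mapE S ` carrier (sdom S)}\<rparr>"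
  "scod (reduced_system S) = (scod S)\<lparr>carrier := mapE S ` carrier (sdom S)\<rparr>"
  "mapE (reduced_system S) = mapE S"
  "mapA (reduced_system S) = mapA S"
  by (simp_all add: reduced_system_def Let_def)

lemma mapE_funpow_reduced [simp]: "mapE ((reduced_system ^^ k) S) = mapE S"
  by (induction k) (simp_all add: reduced_system_simps)

context
  fixes K :: "('k, 'c) ring_scheme" and S :: "('k, 'm, 'v) system"
  assumes S: "is_system K S"
begin

interpretation E: linear_map K "sdom S" "scod S" "mapE S"
  using S by (simp add: is_system_def)
interpretation A: linear_map K "sdom S" "scod S" "mapA S"
  using S by (simp add: is_system_def)

lemma reduced_cod_subspace: "subspace K (carrier (scod (reduced_system S))) (scod S)"
  using E.imT_is_subspace by (simp add: reduced_system_simps E.im_def)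

text \<open>This set is the preimage under \<open>mapA S\<close> of the image of
  \<open>mapE S\<close>, itself a subspace.\<close>

lemma reduced_dom_subspace: "subspace K (carrier (sdom (reduced_system S))) (sdom S)"
proof (rule subspaceI)
  interpret V': submodule K "mapE S ` carrier (sdom S)" "scod S"
    using E.im_is_submodule by (simp add: E.im_def)
  show "\<zero>\<^bsub>sdom S\<^esub> \<in> carrier (sdom (reduced_system S))"
    by (simp add: reduced_system_simps)
  fix v w assume "v \<in> carrier (sdom (reduced_system S))" "w \<in> carrier (sdom (reduced_system S))"
  then show "v \<oplus>\<^bsub>sdom S\<^esub> w \<in> carrier (sdom (reduced_system S))"
    by (simp add: reduced_system_simps)
next
  interpret V': submodule K "mapE S ` carrier (sdom S)" "scod S"
    using E.im_is_submodule by (simp add: E.im_def)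
  fix c v assume "c \<in> carrier K" "v \<in> carrier (sdom (reduced_system S))"
  then show "c \<odot>\<^bsub>sdom S\<^esub> v \<in> carrier (sdom (reduced_system S))"
    by (simp add: reduced_system_simps)
qed (unfold_locales, auto simp: reduced_system_simps)

lemma fin_dim_dom: "vectorspace.fin_dim K (sdom S)"
  and fin_dim_cod: "vectorspace.fin_dim K (scod S)"
  using S by (simp_all add: is_system_def)

lemma reduced_is_system: "is_system K (reduced_system S)"
proof -
  let ?M' = "sdom (reduced_system S)" and ?V' = "scod (reduced_system S)"
  have vs: "vectorspace K ?M'" "vectorspace K ?V'"
    using E.V.subspace_is_vs[OF reduced_dom_subspace] E.W.subspace_is_vs[OF reduced_cod_subspace]
    by (simp_all add: reduced_system_simps)
  have "vectorspace.fin_dim K ?M'" "vectorspace.fin_dim K ?V'"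
    using E.V.fin_dim_subspace[OF fin_dim_dom reduced_dom_subspace]
      E.W.fin_dim_subspace[OF fin_dim_cod reduced_cod_subspace]
    by (simp_all add: reduced_system_simps)
  moreover have "linear_map K ?M' ?V' (mapE S)" "linear_map K ?M' ?V' (mapA S)"
    by (intro linear_mapI vs; auto simp: reduced_system_simps)+
  ultimately show ?thesis by (simp add: is_system_def reduced_system_simps)
qed

lemma dim_reduced_dom_le: "vectorspace.dim K (sdom (reduced_system S)) \<le> vectorspace.dim K (sdom S)"
  using dim_subspace_le[OF reduced_dom_subspace fin_dim_dom] by (simp add: reduced_system_simps)

lemma dim_reduced_cod_le: "vectorspace.dim K (scod (reduced_system S)) \<le> vectorspace.dim K (scod S)"
  using dim_subspace_le[OF reduced_cod_subspace fin_dim_cod] by (simp add: reduced_system_simps)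

text \<open>Reduction keeps the maps and passes to subspaces, and a subspace of full finite
  dimension is everything. Stationarity thus becomes a question about two numbers.\<close>

lemma reduced_eqI:
  assumes "vectorspace.dim K (sdom (reduced_system S)) = vectorspace.dim K (sdom S)"
    and "vectorspace.dim K (scod (reduced_system S)) = vectorspace.dim K (scod S)"
  shows "reduced_system S = S"
proof -
  have "carrier (sdom (reduced_system S)) = carrier (sdom S)"
    using subspace_eq_carrier[OF reduced_dom_subspace fin_dim_dom] assms(1)
    by (simp add: reduced_system_simps)
  moreover have "carrier (scod (reduced_system S)) = carrier (scod S)"
    using subspace_eq_carrier[OF reduced_cod_subspace fin_dim_cod] assms(2)
    by (simp add: reduced_system_simps)
  ultimately show ?thesis
    by (simp add: reduced_system_def Let_def)
qed

text \<open>\<open>M'\<close> is the full preimage of \<open>V'\<close> under \<open>A\<close>, so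
  \<open>[A]\<close> is injective and \<open>\<beta>\<^sup>+\<^sub>1 = dim V/V' - dim M/M'\<close>;
  the equation says this without subtraction.\<close>

lemma beta1_plus_dims:
  "beta1_plus K S + vectorspace.dim K (sdom S) + vectorspace.dim K (scod (reduced_system S))
    = vectorspace.dim K (scod S) + vectorspace.dim K (sdom (reduced_system S))"
proof -
  have "beta1_plus K S + vectorspace.dim K (quotient_space (sdom S) (carrier (sdom (reduced_system S))))
      = vectorspace.dim K (quotient_space (scod S) (carrier (scod (reduced_system S))))"
    unfolding beta1_plus_def Let_def
    by (intro dim_coker_induced_map reduced_dom_subspace reduced_cod_subspace A.linear_map_axioms
        fin_dim_dom fin_dim_cod) (auto simp: reduced_system_simps)
  then show ?thesis
    using dim_quotient[OF reduced_dom_subspace fin_dim_dom] dim_quotient[OF reduced_cod_subspace fin_dim_cod]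
    by (simp add: reduced_system_simps)
qed

end

text \<open>Since \<open>V' = E M\<close>, the map \<open>[E]\<close> is surjective, and
  rank-nullity gives \<open>\<alpha>\<^sub>1 = dim M/M' - dim V'/V''\<close>.\<close>

lemma alpha1_dims:
  assumes S: "is_system K S"
  shows "alpha1 K S + vectorspace.dim K (scod (reduced_system S)) + vectorspace.dim K (sdom (reduced_system S))
    = vectorspace.dim K (sdom S) + vectorspace.dim K (scod (reduced_system (reduced_system S)))"
proof -
  let ?V' = "scod (reduced_system S)" and ?V'' = "scod (reduced_system (reduced_system S))"
  interpret E: linear_map K "sdom S" "scod S" "mapE S"
    using S by (simp add: is_system_def)
  have S': "is_system K (reduced_system S)" using S by (rule reduced_is_system)
  \<comment> \<open>The codomain is cut down to the image, which makes \<open>E\<close>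
    surjective.\<close>
  have "linear_map K (sdom S) ?V' (mapE S)"
    using S' by (intro linear_mapI) (auto simp: is_system_def linear_map_def reduced_system_simps
        intro: E.V.vectorspace_axioms)
  then have "alpha1 K S + vectorspace.dim K (quotient_space ?V' (carrier ?V''))
      = vectorspace.dim K (quotient_space (sdom S) (carrier (sdom (reduced_system S))))"
    unfolding alpha1_def Let_def
    by (rule dim_ker_induced_map[OF _ reduced_dom_subspace[OF S] reduced_cod_subspace[OF S'] _ fin_dim_dom[OF S]])
      (auto simp: reduced_system_simps)
  then show ?thesis
    using dim_quotient[OF reduced_dom_subspace[OF S] fin_dim_dom[OF S]]
      dim_quotient[OF reduced_cod_subspace[OF S'] fin_dim_cod[OF S']]
    by (simp add: reduced_system_simps)
qed

lemma funpow_reduced_is_system: "is_system K S \<Longrightarrow> is_system K ((reduced_system ^^ k) S)"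
  by (induction k) (simp_all add: reduced_is_system)

section \<open>Dimension sequences and summation by parts\<close>

definition dim_dom :: "('k, 'c) ring_scheme \<Rightarrow> ('k, 'm, 'v) system \<Rightarrow> nat \<Rightarrow> nat" where
  "dim_dom K S k = vectorspace.dim K (sdom ((reduced_system ^^ k) S))"

definition dim_cod :: "('k, 'c) ring_scheme \<Rightarrow> ('k, 'm, 'v) system \<Rightarrow> nat \<Rightarrow> nat" where
  "dim_cod K S k = vectorspace.dim K (scod ((reduced_system ^^ k) S))"

text \<open>Defects are numbered from 1, so \<open>Suc k\<close> belongs to the \<open>k\<close>-th
  reduced system.\<close>

lemma alpha_dims:
  assumes "is_system K S"
  shows "alpha K S (Suc k) + dim_cod K S (Suc k) + dim_dom K S (Suc k) = dim_dom K S k + dim_cod K S (Suc (Suc k))"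
  using alpha1_dims[OF funpow_reduced_is_system[OF assms, of k]]
  by (simp add: alpha_def dim_dom_def dim_cod_def)

lemma beta_plus_dims:
  assumes "is_system K S"
  shows "beta_plus K S (Suc k) + dim_dom K S k + dim_cod K S (Suc k) = dim_cod K S k + dim_dom K S (Suc k)"
  using beta1_plus_dims[OF funpow_reduced_is_system[OF assms, of k]]
  by (simp add: beta_plus_def dim_dom_def dim_cod_def)

lemma reduced_total_reduction:
  assumes S: "is_system K S"
  shows "reduced_system (total_reduction S) = total_reduction S"
proof -
  let ?d = "\<lambda>k. dim_dom K S k + dim_cod K S k"
  have le: "dim_dom K S (Suc k) \<le> dim_dom K S k" "dim_cod K S (Suc k) \<le> dim_cod K S k" for k
    using dim_reduced_dom_le dim_reduced_cod_le funpow_reduced_is_system[OF S, of k]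
    by (auto simp: dim_dom_def dim_cod_def)
  \<comment> \<open>Neither dimension ever grows, so at a minimum of their sum neither can drop
    further.\<close>
  define k where "k = (ARG_MIN ?d k. True)"
  have "?d k \<le> ?d (Suc k)"
    unfolding k_def by (rule arg_min_nat_le) simp
  then have "dim_dom K S (Suc k) = dim_dom K S k" "dim_cod K S (Suc k) = dim_cod K S k"
    using le[of k] by linarith+
  then have "(reduced_system ^^ (k + 1)) S = (reduced_system ^^ k) S"
    using reduced_eqI[OF funpow_reduced_is_system[OF S, of k]] by (simp add: dim_dom_def dim_cod_def)
  \<comment> \<open>The index is a \<open>LEAST\<close>, which has its defining property only
    because a stationary stage has been exhibited.\<close>
  then have "(reduced_system ^^ (system_index S + 1)) S = (reduced_system ^^ system_index S) S"
    unfolding system_index_def by (rule LeastI)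
  then show ?thesis by (simp add: total_reduction_def)
qed

lemma funpow_reduced_stable:
  assumes "is_system K S" and "system_index S \<le> k"
  shows "(reduced_system ^^ k) S = total_reduction S"
  using assms(2)
proof (induction k rule: dec_induct)
  case base
  then show ?case by (simp add: total_reduction_def)
next
  case (step k)
  then show ?case using reduced_total_reduction[OF assms(1)] by simp
qed

text \<open>The hypothesis makes \<open>g\<close> the second difference of \<open>x\<close>. Once
  \<open>x (Suc N) = x N\<close>, the identity reads
  \<open>x 0 = x N + (\<Sum>k=1..N. k * g k)\<close>.\<close>

lemma sum_second_difference:
  fixes g x :: "nat \<Rightarrow> nat"
  assumes "\<And>k. g (Suc k) + 2 * x (Suc k) = x k + x (Suc (Suc k))"
  shows "x 0 + N * x (Suc N) = Suc N * x N + (\<Sum>k=1..N. k * g k)"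
proof (induction N)
  case (Suc N)
  \<comment> \<open>The relation at \<open>N\<close>, weighted by \<open>Suc N\<close>, is what must
    be added to the induction hypothesis.\<close>
  have "Suc N * (g (Suc N) + 2 * x (Suc N)) = Suc N * (x N + x (Suc (Suc N)))"
    using assms by simp
  then show ?case using Suc by (simp add: algebra_simps)
qed simp

lemma sum_support:
  fixes g :: "nat \<Rightarrow> nat"
  assumes "\<forall>k>N. g k = 0"
  shows "finite {k. 1 \<le> k \<and> g k \<noteq> 0}"
    and "(\<Sum>k | 1 \<le> k \<and> g k \<noteq> 0. k * g k) = (\<Sum>k=1..N. k * g k)"
proof -
  have sub: "{k. 1 \<le> k \<and> g k \<noteq> 0} \<subseteq> {1..N}"
    using assms by (auto simp: not_less[symmetric])
  then show "finite {k. 1 \<le> k \<and> g k \<noteq> 0}" by (rule finite_subset) simp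
  show "(\<Sum>k | 1 \<le> k \<and> g k \<noteq> 0. k * g k) = (\<Sum>k=1..N. k * g k)"
    using sub by (intro sum.mono_neutral_left) auto
qed

text \<open>The one-sided form of the result, with the totally reduced dimensions as remainders. It
  is applied to \<open>S\<close> and again to the dual of its total reduction.\<close>

lemma reduction_dims:
  assumes S: "is_system K S"
  shows "finite {k. 1 \<le> k \<and> alpha K S k \<noteq> 0}"
    and "finite {k. 1 \<le> k \<and> beta_plus K S k \<noteq> 0}"
    and "vectorspace.dim K (sdom S) = vectorspace.dim K (sdom (total_reduction S))
      + (\<Sum>k | 1 \<le> k \<and> alpha K S k \<noteq> 0. k * alpha K S k)
      + (\<Sum>k | 1 \<le> k \<and> beta_plus K S (k + 1) \<noteq> 0. k * beta_plus K S (k + 1))"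
    and "vectorspace.dim K (scod S) = vectorspace.dim K (scod (total_reduction S))
      + (\<Sum>k | 1 \<le> k \<and> alpha K S k \<noteq> 0. k * alpha K S k)
      + (\<Sum>k | 1 \<le> k \<and> beta_plus K S k \<noteq> 0. k * beta_plus K S k)"
proof -
  define N where "N = system_index S"
  let ?m = "dim_dom K S" and ?v = "dim_cod K S"
  have stable: "?m k = vectorspace.dim K (sdom (total_reduction S))"
    "?v k = vectorspace.dim K (scod (total_reduction S))" if "N \<le> k" for k
    using funpow_reduced_stable[OF S, of k] that by (simp_all add: dim_dom_def dim_cod_def N_def)
  \<comment> \<open>For \<open>k > N\<close> the stages \<open>k - 1\<close>, \<open>k\<close> and
    \<open>Suc k\<close> all have the limit dimensions, so the equation cancels to zero.\<close>
  have alpha0: "\<forall>k>N. alpha K S k = 0"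
  proof (intro allI impI)
    fix k assume "N < k"
    then show "alpha K S k = 0"
      using alpha_dims[OF S, of "k - 1"] stable by (cases k) simp_all
  qed
  have beta0: "\<forall>k>N. beta_plus K S k = 0"
  proof (intro allI impI)
    fix k assume "N < k"
    then show "beta_plus K S k = 0"
      using beta_plus_dims[OF S, of "k - 1"] stable by (cases k) simp_all
  qed
  then have beta0': "\<forall>k>N. beta_plus K S (k + 1) = 0"
    by simp
  note a = sum_support[where g = "alpha K S", OF alpha0]
    and b = sum_support[where g = "beta_plus K S", OF beta0]
    and b' = sum_support[where g = "\<lambda>k. beta_plus K S (k + 1)", OF beta0']
  show "finite {k. 1 \<le> k \<and> alpha K S k \<noteq> 0}" "finite {k. 1 \<le> k \<and> beta_plus K S k \<noteq> 0}"
    by (rule a(1), rule b(1))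
  \<comment> \<open>The shift to \<open>k + 1\<close> makes the terms in \<open>?v\<close> cancel
    between the two equations.\<close>
  have "?m 0 + N * ?m (Suc N) = Suc N * ?m N + (\<Sum>k=1..N. k * (alpha K S k + beta_plus K S (k + 1)))"
  proof (rule sum_second_difference)
    fix k
    show "alpha K S (Suc k) + beta_plus K S (Suc k + 1) + 2 * ?m (Suc k) = ?m k + ?m (Suc (Suc k))"
      using alpha_dims[OF S, of k] beta_plus_dims[OF S, of "Suc k"] by simp
  qed
  then show "vectorspace.dim K (sdom S) = vectorspace.dim K (sdom (total_reduction S))
      + (\<Sum>k | 1 \<le> k \<and> alpha K S k \<noteq> 0. k * alpha K S k)
      + (\<Sum>k | 1 \<le> k \<and> beta_plus K S (k + 1) \<noteq> 0. k * beta_plus K S (k + 1))"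
    unfolding a(2) b'(2) by (simp add: stable dim_dom_def[of K S 0] sum.distrib distrib_left)
  \<comment> \<open>Without the shift it is the terms in \<open>?m\<close> that cancel.\<close>
  have "?v 0 + N * ?v (Suc N) = Suc N * ?v N + (\<Sum>k=1..N. k * (alpha K S k + beta_plus K S k))"
  proof (rule sum_second_difference)
    fix k
    show "alpha K S (Suc k) + beta_plus K S (Suc k) + 2 * ?v (Suc k) = ?v k + ?v (Suc (Suc k))"
      using alpha_dims[OF S, of k] beta_plus_dims[OF S, of k] by simp
  qed
  then show "vectorspace.dim K (scod S) = vectorspace.dim K (scod (total_reduction S))
      + (\<Sum>k | 1 \<le> k \<and> alpha K S k \<noteq> 0. k * alpha K S k)
      + (\<Sum>k | 1 \<le> k \<and> beta_plus K S k \<noteq> 0. k * beta_plus K S k)"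
    unfolding a(2) b(2) by (simp add: stable dim_cod_def[of K S 0] sum.distrib distrib_left)
qed

section \<open>Dual systems and systems with injective \<open>E\<close>\<close>

lemma dual_is_system:
  assumes S: "is_system K S"
  shows "is_system K (dual_system K S)"
proof -
  interpret E: linear_map K "sdom S" "scod S" "mapE S"
    using S by (simp add: is_system_def)
  interpret A: linear_map K "sdom S" "scod S" "mapA S"
    using S by (simp add: is_system_def)
  show ?thesis
    using E.adjoint_linear A.adjoint_linear E.V.dual_space_fin_dim[OF fin_dim_dom[OF S]]
      E.W.dual_space_fin_dim[OF fin_dim_cod[OF S]]
    by (simp add: is_system_def dual_system_def)
qed

lemma dim_reduced_cod_of_inj:
  assumes S: "is_system K S" and inj: "inj_on (mapE S) (carrier (sdom S))"
  shows "vectorspace.dim K (scod (reduced_system S)) = vectorspace.dim K (sdom S)"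
proof -
  interpret E: linear_map K "sdom S" "scod S" "mapE S"
    using S by (simp add: is_system_def)
  show ?thesis
    using E.rank_nullity[OF fin_dim_dom[OF S]] E.inj_imp_dim_ker0[OF inj]
    by (simp add: E.im_def reduced_system_simps)
qed

lemma carrier_dom_funpow_reduced_subset:
  "carrier (sdom ((reduced_system ^^ k) S)) \<subseteq> carrier (sdom S)"
proof (induction k)
  case (Suc k)
  then show ?case by (auto simp: reduced_system_simps)
qed simp

text \<open>If \<open>E\<close> is injective, it identifies the domain of each reduced system with the codomain of
  the next, so all \<open>\<alpha>\<^sub>k\<close> vanish.\<close>

lemma
  assumes S: "is_system K S" and inj: "inj_on (mapE S) (carrier (sdom S))"
  shows alpha_of_inj: "1 \<le> k \<Longrightarrow> alpha K S k = 0"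
    and dim_total_reduction_of_inj:
      "vectorspace.dim K (scod (total_reduction S)) = vectorspace.dim K (sdom (total_reduction S))"
proof -
  have *: "dim_cod K S (Suc j) = dim_dom K S j" for j
    using dim_reduced_cod_of_inj[OF funpow_reduced_is_system[OF S, of j]]
      inj_on_subset[OF inj carrier_dom_funpow_reduced_subset]
    by (simp add: dim_cod_def dim_dom_def)
  show "alpha K S k = 0" if "1 \<le> k"
    using that alpha_dims[OF S, of "k - 1"] * by (cases k) simp_all
  \<comment> \<open>At the index, stage and successor stage are both the total reduction, so the
    shifted equality compares its own two dimensions.\<close>
  show "vectorspace.dim K (scod (total_reduction S)) = vectorspace.dim K (sdom (total_reduction S))"
    using *[of "system_index S"] funpow_reduced_stable[OF S, of "Suc (system_index S)"]
      funpow_reduced_stable[OF S, of "system_index S"]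
    by (simp add: dim_cod_def dim_dom_def del: funpow.simps)
qed

theorem proposition3p15:
  fixes K :: "('k, 'c) ring_scheme" and S :: "('k, 'm, 'v) system"
  assumes "is_system K S"
  shows
   "finite {k. 1 \<le> k \<and> alpha K S k \<noteq> 0} \<and>
    finite {k. 1 \<le> k \<and> beta_plus K S k \<noteq> 0} \<and>
    finite {k. 1 \<le> k \<and> beta_minus K S k \<noteq> 0} \<and>
    vectorspace.dim K (sdom S) =
           dynamical_dim K S
           + (\<Sum>k | 1 \<le> k \<and> alpha K S k \<noteq> 0. k * alpha K S k)
           + (\<Sum>k | 1 \<le> k \<and> beta_minus K S k \<noteq> 0. k * beta_minus K S k)
           + (\<Sum>k | 1 \<le> k \<and> beta_plus K S (k + 1) \<noteq> 0. k * beta_plus K S (k + 1)) \<and>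
    vectorspace.dim K (scod S) =
           dynamical_dim K S
           + (\<Sum>k | 1 \<le> k \<and> alpha K S k \<noteq> 0. k * alpha K S k)
           + (\<Sum>k | 1 \<le> k \<and> beta_plus K S k \<noteq> 0. k * beta_plus K S k)
           + (\<Sum>k | 1 \<le> k \<and> beta_minus K S (k + 1) \<noteq> 0. k * beta_minus K S (k + 1))"
proof -
  define T where "T = total_reduction S"
  define D where "D = dual_system K T"
  have T: "is_system K T"
    unfolding T_def total_reduction_def using assms by (rule funpow_reduced_is_system)
  have D: "is_system K D"
    unfolding D_def using T by (rule dual_is_system)
  interpret E: linear_map K "sdom T" "scod T" "mapE T"
    using T by (simp add: is_system_def)
  \<comment> \<open>\<open>T\<close> equals its own reduction, whose codomain is the image of
    \<open>E\<close>.\<close>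
  have "mapE T ` carrier (sdom T) = carrier (scod T)"
    using arg_cong[OF reduced_total_reduction[OF assms], of "\<lambda>S. carrier (scod S)"]
    by (simp add: T_def reduced_system_simps)
  then have inj: "inj_on (mapE D) (carrier (sdom D))"
    using E.adjoint_inj by (simp add: D_def dual_system_def)
  have "(\<Sum>k | 1 \<le> k \<and> alpha K D k \<noteq> 0. k * alpha K D k) = 0"
    using alpha_of_inj[OF D inj] by (intro sum.neutral) auto
  \<comment> \<open>Dualizing exchanges domain and codomain. Hence \<open>dim M\<close> receives the
    unshifted and \<open>dim V\<close> the shifted sum of the
    \<open>\<beta>\<^sup>-\<^sub>k\<close>.\<close>
  moreover have "vectorspace.dim K (sdom D) = vectorspace.dim K (scod T)"
    and "vectorspace.dim K (scod D) = vectorspace.dim K (sdom T)"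
    using E.V.dual_space_dim[OF fin_dim_dom[OF T]] E.W.dual_space_dim[OF fin_dim_cod[OF T]]
    by (simp_all add: D_def dual_system_def)
  moreover have beta_minus: "beta_minus K S = beta_plus K D"
    by (simp add: fun_eq_iff beta_minus_def D_def T_def)
  moreover have "dynamical_dim K S = vectorspace.dim K (sdom (total_reduction D))"
    by (simp add: dynamical_dim_def D_def T_def)
  \<comment> \<open>The formulas for \<open>D\<close> are substituted for the remainders in those
    for \<open>S\<close>; both remainders of \<open>D\<close> equal the dynamical dimension.\<close>
  ultimately show ?thesis
    using reduction_dims[OF assms] reduction_dims[OF D] dim_total_reduction_of_inj[OF D inj]
    unfolding T_def[symmetric] by simp
qed

end
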